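(* Let $\mathcal H$ be a real Hilbert space and $\gamma>0$. Let $f\in C^2(\mathcal H)$ be real-valued with $\inf_{\mathcal H}f>-\infty$, $\nabla f$ globally $L$-Lipschitz continuous for some $L\ge0$, $\nabla^2f:\mathcal H\to\mathcal L(\mathcal H)$ bounded on bounded sets and Lipschitz continuous in operator norm on every bounded set, and suppose there is $\kappa\ge0$ with $\langle\nabla^2f(x)u,u\rangle\ge-\kappa\|u\|^2$ for all $x,u\in\mathcal H$. Let $\phi:\mathcal H\to\mathbb R\cup\{+\infty\}$ be proper, lower semicontinuous and convex with $\phi(0)=\min\phi=0$ and $r\mathbb B\subseteq\partial\phi(0)$ for some $r>0$. Fix initial data $x_0,v_0\in\mathcal H$. For $\beta\ge0$ and $h>0$ define two sequences $(x_k^J,v_k^J)_{k\ge0}$, $J\in\{E,I\}$, by $x_0^J=x_0$, $v_0^J=v_0$, $x_{-1}^E=x_0-hv_0$, and for $k\ge0$ $$v_{k+1}^J=\mathrm{prox}_{\lambda_h\phi}\left(a_hv_k^J-\lambda_hG_k^J\right),\qquad x_{k+1}^J=x_k^J+hv_{k+1}^J,\qquad a_h=\frac1{1+h\gamma},\quad\lambda_h=\frac{h}{1+h\gamma},$$ where $$G_k^E=\nabla f(x_k^E)+\frac\beta h\bigl(\nabla f(x_k^E)-\nabla f(x_{k-1}^E)\bigr),\qquad G_k^I=\nabla f(x_k^I+\beta v_k^I).$$ Fix $T>0$, $\bar\beta>0$, $\bar h>0$. Then there exists $C_T>0$, independent of $\beta$ and $h$, such that $$\max_{0\le kh\le T}\left(\|x_k^I-x_k^E\|+\|v_k^I-v_k^E\|\right)\le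 C_T\left(\beta^2+\beta h\right)$$ for every $0\le\beta\le\bar\beta$ and $0<h\le\bar h$. If $f$ is quadratic, the two complete discrete trajectories coincide for every $\beta\ge0$ and $h>0$.
   Context: $\mathbb B$ is the closed unit ball; $\partial\phi$ is the convex subdifferential; $\mathrm{prox}_{\lambda\phi}(p)=\mathrm{arg\,min}_{w\in\mathcal H}\{\lambda\phi(w)+\frac12\|w-p\|^2\}$. *)

theory Defs
  imports "HOL-Analysis.Analysis"
begin

text \<open>Real Hilbert spaces are types of sort \<open>{real_inner, complete_space}\<close>.\<close>

definition proper_fun :: "('a \<Rightarrow> ereal) \<Rightarrow> bool" where
  "proper_fun \<phi> \<longleftrightarrow> (\<forall>x. \<phi> x \<noteq> -\<infinity>) \<and> (\<exists>x. \<phi> x \<noteq> \<infinity>)"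

definition lsc_fun :: "('a::topological_space \<Rightarrow> ereal) \<Rightarrow> bool" where
  "lsc_fun \<phi> \<longleftrightarrow> (\<forall>x. \<phi> x \<le> Liminf (at x) \<phi>)"

text \<open>The library's \<open>convex_on\<close> only covers real-valued functions. The inequality below is
  only meant for functions that never take the value \<open>-\<infinity>\<close>; recall that \<open>0 * \<infinity> = 0\<close>
  in \<open>ereal\<close>.\<close>

definition convex_fun :: "('a::real_vector \<Rightarrow> ereal) \<Rightarrow> bool" where
  "convex_fun \<phi> \<longleftrightarrow>
     (\<forall>x y. \<forall>u\<ge>0. \<forall>v\<ge>0. u + v = 1 \<longrightarrow>
        \<phi> (u *\<^sub>R x + v *\<^sub>R y) \<le> ereal u * \<phi> x + ereal v * \<phi> y)"

definition subdifferential :: "('a::real_inner \<Rightarrow> ereal) \<Rightarrow> 'a \<Rightarrow> 'a set" where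
  "subdifferential \<phi> x = {p. \<forall>y. \<phi> x + ereal (p \<bullet> (y - x)) \<le> \<phi> y}"

text \<open>For \<open>l > 0\<close> and proper, lower semicontinuous, convex \<open>\<phi>\<close> on a Hilbert space the
  minimiser exists and is unique.\<close>

definition prox :: "real \<Rightarrow> ('a::real_inner \<Rightarrow> ereal) \<Rightarrow> 'a \<Rightarrow> 'a" where
  "prox l \<phi> p = (ARG_MIN (\<lambda>w. ereal l * \<phi> w + ereal (1 / 2 * (norm (w - p))\<^sup>2)) w. True)"

definition prox_step ::
  "('a::real_inner \<Rightarrow> ereal) \<Rightarrow> real \<Rightarrow> real \<Rightarrow> 'a \<Rightarrow> 'a \<Rightarrow> 'a" where
  "prox_step \<phi> \<gamma> h v G =
     (let a = 1 / (1 + h * \<gamma>); l = h / (1 + h * \<gamma>)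
      in prox l \<phi> (a *\<^sub>R v - l *\<^sub>R G))"

text \<open>Explicit Hessian damping (index \<open>E\<close>); the state at step \<open>k\<close> is
  \<open>(x\<^sub>k\<^sub>-\<^sub>1, x\<^sub>k, v\<^sub>k)\<close>.\<close>

primrec explicit_state ::
  "('a::real_inner \<Rightarrow> 'a) \<Rightarrow> ('a \<Rightarrow> ereal) \<Rightarrow> real \<Rightarrow> 'a \<Rightarrow> 'a \<Rightarrow> real \<Rightarrow> real \<Rightarrow> nat
    \<Rightarrow> 'a \<times> 'a \<times> 'a" where
  "explicit_state gradf \<phi> \<gamma> x0 v0 \<beta> h 0 = (x0 - h *\<^sub>R v0, x0, v0)"
| "explicit_state gradf \<phi> \<gamma> x0 v0 \<beta> h (Suc k) =
     (let (xprev, x, v) = explicit_state gradf \<phi> \<gamma> x0 v0 \<beta> h k;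
          v' = prox_step \<phi> \<gamma> h v (gradf x + (\<beta> / h) *\<^sub>R (gradf x - gradf xprev))
      in (x, x + h *\<^sub>R v', v'))"

definition explicit_x where
  "explicit_x gradf \<phi> \<gamma> x0 v0 \<beta> h k = fst (snd (explicit_state gradf \<phi> \<gamma> x0 v0 \<beta> h k))"

definition explicit_v where
  "explicit_v gradf \<phi> \<gamma> x0 v0 \<beta> h k = snd (snd (explicit_state gradf \<phi> \<gamma> x0 v0 \<beta> h k))"

text \<open>Implicit Hessian damping (index \<open>I\<close>); the state at step \<open>k\<close> is \<open>(x\<^sub>k, v\<^sub>k)\<close>.\<close>

primrec implicit_state ::
  "('a::real_inner \<Rightarrow> 'a) \<Rightarrow> ('a \<Rightarrow> ereal) \<Rightarrow> real \<Rightarrow> 'a \<Rightarrow> 'a \<Rightarrow> real \<Rightarrow> real \<Rightarrow> nat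
    \<Rightarrow> 'a \<times> 'a" where
  "implicit_state gradf \<phi> \<gamma> x0 v0 \<beta> h 0 = (x0, v0)"
| "implicit_state gradf \<phi> \<gamma> x0 v0 \<beta> h (Suc k) =
     (let (x, v) = implicit_state gradf \<phi> \<gamma> x0 v0 \<beta> h k;
          v' = prox_step \<phi> \<gamma> h v (gradf (x + \<beta> *\<^sub>R v))
      in (x + h *\<^sub>R v', v'))"

definition implicit_x where
  "implicit_x gradf \<phi> \<gamma> x0 v0 \<beta> h k = fst (implicit_state gradf \<phi> \<gamma> x0 v0 \<beta> h k)"

definition implicit_v where
  "implicit_v gradf \<phi> \<gamma> x0 v0 \<beta> h k = snd (implicit_state gradf \<phi> \<gamma> x0 v0 \<beta> h k)"

definition quadratic_fun :: "('a::real_inner \<Rightarrow> real) \<Rightarrow> bool" where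
  "quadratic_fun f \<longleftrightarrow>
     (\<exists>(A :: 'a \<Rightarrow>\<^sub>L 'a) b c.
        (\<forall>x y. blinfun_apply A x \<bullet> y = x \<bullet> blinfun_apply A y) \<and>
        (\<forall>x. f x = 1 / 2 * (blinfun_apply A x \<bullet> x) + b \<bullet> x + c))"

end

theory Submission
  imports Defs
begin

text \<open>Since \<open>\<phi> \<ge> 0 = \<phi> 0\<close>, the proximal map is nonexpansive and fixes \<open>0\<close>, so a discrete Gronwall
  argument bounds the explicit trajectory on \<open>[0, T]\<close> uniformly in \<open>\<beta>\<close> and \<open>h\<close>. Along it
  \<open>x\<^sub>k - x\<^sub>k\<^sub>-\<^sub>1 = h v\<^sub>k\<close>, hence both damping terms approximate \<open>\<nabla>f(x) + \<beta> \<nabla>\<^sup>2f(x) v\<close>, with errors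
  \<open>O(\<beta>\<^sup>2)\<close> and \<open>O(\<beta>h)\<close> by the local Lipschitz continuity of the Hessian. Nonexpansiveness and a
  second Gronwall argument propagate this defect; for an affine gradient it vanishes.\<close>

section \<open>The proximal map\<close>

text \<open>The strong convexity of the squared distance holds with equality. The deficit
  \<open>t * (1 - t) * (norm (x - y))\<^sup>2\<close> is the source of both existence and
  nonexpansiveness of the proximal point.\<close>

lemma norm_convex_comb_diff:
  fixes x y p :: "'a::real_inner"
  shows "(norm ((1 - t) *\<^sub>R x + t *\<^sub>R y - p))\<^sup>2 =
    (1 - t) * (norm (x - p))\<^sup>2 + t * (norm (y - p))\<^sup>2 - t * (1 - t) * (norm (x - y))\<^sup>2"
proof -
  define a b where "a = x - p" and "b = y - p"
  have 1: "(1 - t) *\<^sub>R x + t *\<^sub>R y - p = (1 - t) *\<^sub>R a + t *\<^sub>R b" "x - y = a - b"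
    by (auto simp: a_def b_def algebra_simps)
  show ?thesis
    unfolding 1 unfolding a_def[symmetric] b_def[symmetric]
    by (simp add: power2_norm_eq_inner inner_simps inner_commute[of b a]) algebra
qed

locale nonneg_convex_lsc =
  fixes \<phi> :: "'a::{real_inner,complete_space} \<Rightarrow> ereal"
  assumes lsc: "lsc_fun \<phi>"
    and conv: "convex_fun \<phi>"
    and zero: "\<phi> 0 = 0"
    and nonneg: "0 \<le> \<phi> x"
begin

text \<open>This is verbatim the function minimised in \<open>prox\<close>, so facts about it
  transfer by unfolding.\<close>

definition prox_obj :: "real \<Rightarrow> 'a \<Rightarrow> 'a \<Rightarrow> ereal" where
  "prox_obj l p w = ereal l * \<phi> w + ereal (1 / 2 * (norm (w - p))\<^sup>2)"

section \<open>Sublevel sets of the proximal objective and existence of a minimiser\<close>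

lemma prox_obj_nonneg: "l > 0 \<Longrightarrow> 0 \<le> prox_obj l p w"
  using nonneg[of w] by (simp add: prox_obj_def)

lemma prox_obj_zero: "prox_obj l p 0 = ereal (1 / 2 * (norm p)\<^sup>2)"
  by (simp add: prox_obj_def zero)

text \<open>Moves the quadratic part to the real side, so that extended values enter only through
  \<phi>. Nonnegativity excludes minus infinity, and at plus infinity both sides are false.\<close>

lemma prox_obj_le_iff:
  assumes "l > 0"
  shows "prox_obj l p w \<le> ereal c \<longleftrightarrow> \<phi> w \<le> ereal ((c - 1 / 2 * (norm (w - p))\<^sup>2) / l)"
  using assms nonneg[of w] unfolding prox_obj_def
  by (cases "\<phi> w") (auto simp: field_simps)

text \<open>Convexity of \<phi> is combined with the exact identity for the quadratic term. Real
  upper bounds \<open>A\<close> and \<open>B\<close> replace the values themselves, so the estimate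
  also serves for approximate minimisers.\<close>

lemma prox_obj_strongly_convex:
  assumes "l > 0" "0 \<le> t" "t \<le> 1"
    and x: "prox_obj l p x \<le> ereal A" and y: "prox_obj l p y \<le> ereal B"
  shows "prox_obj l p ((1 - t) *\<^sub>R x + t *\<^sub>R y)
    \<le> ereal ((1 - t) * A + t * B - t * (1 - t) / 2 * (norm (x - y))\<^sup>2)"
proof -
  let ?qx = "1 / 2 * (norm (x - p))\<^sup>2" and ?qy = "1 / 2 * (norm (y - p))\<^sup>2"
  have "\<phi> ((1 - t) *\<^sub>R x + t *\<^sub>R y) \<le> ereal (1 - t) * \<phi> x + ereal t * \<phi> y"
    using conv assms unfolding convex_fun_def by auto
  also have "\<dots> \<le> ereal (1 - t) * ereal ((A - ?qx) / l) + ereal t * ereal ((B - ?qy) / l)"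
    using x y assms(1-3) unfolding prox_obj_le_iff[OF assms(1)]
    by (intro add_mono ereal_mult_left_mono) auto
  also have "\<dots> = ereal (((1 - t) * A + t * B - t * (1 - t) / 2 * (norm (x - y))\<^sup>2
      - 1 / 2 * (norm ((1 - t) *\<^sub>R x + t *\<^sub>R y - p))\<^sup>2) / l)"
    unfolding norm_convex_comb_diff using assms(1) by (simp add: field_simps)
  finally show ?thesis
    unfolding prox_obj_le_iff[OF assms(1)] .
qed

text \<open>The sublevel set is where \<phi> lies below a continuous function \<open>q\<close>. If
  \<phi> exceeds \<open>q\<close> at a point, a level \<open>d\<close> strictly between them
  separates the two nearby, by lower semicontinuity on one side and continuity on the other.\<close>

lemma closed_sublevel_prox_obj:
  assumes "l > 0"
  shows "closed {w. prox_obj l p w \<le> ereal c}"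
proof -
  define q where "q w = (c - 1 / 2 * (norm (w - p))\<^sup>2) / l" for w
  have "\<exists>S. open S \<and> x \<in> S \<and> S \<subseteq> {w. \<not> \<phi> w \<le> ereal (q w)}" if x: "\<not> \<phi> x \<le> ereal (q x)" for x
  proof -
    obtain d where d: "ereal (q x) < d" "d < \<phi> x"
      using x dense[of "ereal (q x)" "\<phi> x"] unfolding not_le by blast
    have "(q \<longlongrightarrow> q x) (at x)"
      unfolding q_def using assms by (intro tendsto_intros) auto
    then have "((\<lambda>w. ereal (q w)) \<longlongrightarrow> ereal (q x)) (at x)"
      by (intro tendsto_intros)
    then have "eventually (\<lambda>w. ereal (q w) < d) (at x)"
      using d(1) by (rule order_tendstoD)
    moreover have "eventually (\<lambda>w. d < \<phi> w) (at x)"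
      using lsc d(2) unfolding lsc_fun_def le_Liminf_iff by blast
    ultimately have "eventually (\<lambda>w. ereal (q w) < \<phi> w) (at x)"
      by eventually_elim simp
    \<comment> \<open>\<open>lsc_fun\<close> speaks of punctured neighbourhoods only; the centre
      itself is covered by the assumption on \<open>x\<close>.\<close>
    then have "eventually (\<lambda>w. ereal (q w) < \<phi> w) (nhds x)"
      using that by (simp add: eventually_nhds_conv_at)
    then show ?thesis
      unfolding eventually_nhds not_le by blast
  qed
  then have "open {w. \<not> \<phi> w \<le> ereal (q w)}"
    by (subst open_subopen) auto
  then show ?thesis
    unfolding prox_obj_le_iff[OF assms] closed_def q_def by (simp add: Compl_eq)
qed

text \<open>Cantor intersection instead of weak compactness: the sublevel sets just above the
  infimum are closed, nonempty and nested, and strong convexity forces their diameters to 0, so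
  completeness yields a common point.\<close>

lemma prox_obj_minimiser:
  assumes "l > 0"
  shows "\<exists>w. \<forall>y. prox_obj l p w \<le> prox_obj l p y"
proof -
  define I where "I = (INF w. prox_obj l p w)"
  have I0: "0 \<le> I"
    unfolding I_def by (intro INF_greatest prox_obj_nonneg assms)
  have "I \<le> prox_obj l p 0"
    unfolding I_def by (rule INF_lower) simp
  with I0 obtain m where m: "I = ereal m"
    by (cases I) (auto simp: prox_obj_zero)
  have m_le: "ereal m \<le> prox_obj l p w" for w
    using m unfolding I_def by (metis INF_lower UNIV_I)
  define S where "S n = {w. prox_obj l p w \<le> ereal (m + inverse (real (Suc n)))}" for n
  have "closed (S n)" for n
    unfolding S_def by (rule closed_sublevel_prox_obj[OF assms])
  moreover have "S n \<noteq> {}" for n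
  proof -
    have "I < ereal (m + inverse (real (Suc n)))"
      unfolding m by simp
    then obtain w where "prox_obj l p w < ereal (m + inverse (real (Suc n)))"
      unfolding I_def INF_less_iff by blast
    then show ?thesis
      unfolding S_def by (auto intro: less_imp_le)
  qed
  moreover have "S n \<subseteq> S k" if "k \<le> n" for k n
  proof -
    have "inverse (real (Suc n)) \<le> inverse (real (Suc k))"
      using that by (intro le_imp_inverse_le) auto
    then show ?thesis
      unfolding S_def by (auto elim!: order_trans)
  qed
  moreover have "\<exists>n. \<forall>x\<in>S n. \<forall>y\<in>S n. dist x y < e" if "e > 0" for e
  proof -
    \<comment> \<open>The midpoint of two points of \<open>S n\<close> has value at least
      \<open>m\<close> and at most \<open>m + inverse (real (Suc n))\<close> minus one eighth of
      their squared distance; hence the factor 8.\<close>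
    obtain n where n: "inverse (real (Suc n)) < e\<^sup>2 / 8"
      using reals_Archimedean[of "e\<^sup>2 / 8"] \<open>e > 0\<close> by auto
    have "dist x y < e" if "x \<in> S n" "y \<in> S n" for x y
    proof -
      let ?A = "m + inverse (real (Suc n))"
      have "prox_obj l p ((1 - 1/2) *\<^sub>R x + (1/2) *\<^sub>R y)
          \<le> ereal ((1 - 1/2) * ?A + 1/2 * ?A - 1/2 * (1 - 1/2) / 2 * (norm (x - y))\<^sup>2)"
        using that unfolding S_def by (intro prox_obj_strongly_convex assms) auto
      with m_le have "ereal m \<le>
          ereal ((1 - 1/2) * ?A + 1/2 * ?A - 1/2 * (1 - 1/2) / 2 * (norm (x - y))\<^sup>2)"
        by (rule order_trans)
      then have "(norm (x - y))\<^sup>2 \<le> 8 * inverse (real (Suc n))"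
        by simp
      with n have "(norm (x - y))\<^sup>2 < e\<^sup>2"
        by simp
      then show ?thesis
        unfolding dist_norm using \<open>e > 0\<close> by (simp add: power2_less_imp_less)
    qed
    then show ?thesis
      by blast
  qed
  ultimately obtain w where w: "\<And>n. w \<in> S n"
    using decreasing_closed_nest[of S] by metis
  have "prox_obj l p w \<le> ereal m"
  proof (rule ereal_le_epsilon2)
    fix e :: real assume "e > 0"
    then obtain n where n: "inverse (real (Suc n)) < e"
      using reals_Archimedean by blast
    have "prox_obj l p w \<le> ereal (m + inverse (real (Suc n)))"
      using w[of n] unfolding S_def by simp
    also have "\<dots> \<le> ereal m + ereal e"
      using n by simp
    finally show "prox_obj l p w \<le> ereal m + ereal e" .
  qed
  with m_le show ?thesis
    by (meson order_trans)
qed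

section \<open>Optimality and nonexpansiveness of the proximal point\<close>

lemma prox_minimises:
  assumes "l > 0"
  shows "prox_obj l p (prox l \<phi> p) \<le> prox_obj l p y"
proof -
  obtain w where w: "\<And>y. prox_obj l p w \<le> prox_obj l p y"
    using prox_obj_minimiser[OF assms] by blast
  have "is_arg_min (prox_obj l p) (\<lambda>_. True) w"
    unfolding is_arg_min_def using w by (auto simp: not_less)
  \<comment> \<open>\<open>ARG_MIN\<close> is a Hilbert choice; the minimiser just found guarantees
    that the chosen point satisfies its specification.\<close>
  then have "is_arg_min (prox_obj l p) (\<lambda>_. True) (prox l \<phi> p)"
    unfolding prox_def arg_min_def prox_obj_def by (rule someI)
  then show ?thesis
    unfolding is_arg_min_def by (auto simp: not_less)
qed

lemma prox_finite:
  assumes "l > 0"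
  obtains A where "\<phi> (prox l \<phi> p) = ereal A"
proof -
  have "prox_obj l p (prox l \<phi> p) \<le> ereal (1 / 2 * (norm p)\<^sup>2)"
    using prox_minimises[OF assms, of p 0] by (simp only: prox_obj_zero)
  then show ?thesis
    using that nonneg[of "prox l \<phi> p"] unfolding prox_obj_le_iff[OF assms]
    by (cases "\<phi> (prox l \<phi> p)") auto
qed

text \<open>Minimality is tested against points on the segment from the proximal point to
  \<open>y\<close>. Strong convexity leaves a gain proportional to \<open>t\<close>, which is
  divided out.\<close>

lemma prox_quadratic_growth:
  assumes l: "l > 0" and A: "\<phi> (prox l \<phi> p) = ereal A" and B: "\<phi> y = ereal B"
  shows "l * A + 1 / 2 * (norm (prox l \<phi> p - p))\<^sup>2 + 1 / 2 * (norm (prox l \<phi> p - y))\<^sup>2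
    \<le> l * B + 1 / 2 * (norm (y - p))\<^sup>2"
proof -
  let ?w = "prox l \<phi> p"
  let ?A = "l * A + 1 / 2 * (norm (?w - p))\<^sup>2" and ?B = "l * B + 1 / 2 * (norm (y - p))\<^sup>2"
  let ?N = "1 / 2 * (norm (?w - y))\<^sup>2"
  have FA: "prox_obj l p ?w = ereal ?A" and FB: "prox_obj l p y = ereal ?B"
    by (simp_all add: prox_obj_def A B)
  have *: "?A + (1 - t) * ?N \<le> ?B" if "0 < t" "t < 1" for t
  proof -
    have "ereal ?A \<le> prox_obj l p ((1 - t) *\<^sub>R ?w + t *\<^sub>R y)"
      unfolding FA[symmetric] by (rule prox_minimises[OF l])
    also have "\<dots> \<le> ereal ((1 - t) * ?A + t * ?B - t * (1 - t) / 2 * (norm (?w - y))\<^sup>2)"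
      using that FA FB by (intro prox_obj_strongly_convex l) auto
    finally have "?A \<le> (1 - t) * ?A + t * ?B - t * (1 - t) * ?N"
      by simp
    moreover have "t * (a + (1 - t) * n) \<le> t * b"
      if "a \<le> (1 - t) * a + t * b - t * (1 - t) * n" for a b n :: real
      using that by (simp add: algebra_simps)
    ultimately have "t * (?A + (1 - t) * ?N) \<le> t * ?B"
      by blast
    with that show ?thesis
      by (simp only: mult_le_cancel_left_pos)
  qed
  \<comment> \<open>Letting \<open>t\<close> tend to 0 from the right removes the factor
    \<open>1 - t\<close> and recovers the full coefficient 1/2.\<close>
  have "((\<lambda>t. ?A + (1 - t) * ?N) \<longlongrightarrow> ?A + (1 - 0) * ?N) (at_right 0)"
    by (intro tendsto_intros)
  moreover have "eventually (\<lambda>t::real. ?A + (1 - t) * ?N \<le> ?B) (at_right 0)"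
    using eventually_at_right_real[of 0 "1::real"] by (rule eventually_rev_mp) (use * in auto)
  ultimately have "?A + (1 - 0) * ?N \<le> ?B"
    by (rule tendsto_upperbound) simp
  then show ?thesis
    by simp
qed

text \<open>Each proximal point serves as competitor for the other. Adding the two growth
  inequalities cancels the values of \<phi> and leaves firm nonexpansiveness; Cauchy-Schwarz
  finishes.\<close>

lemma prox_nonexpansive:
  assumes l: "l > 0"
  shows "norm (prox l \<phi> p - prox l \<phi> q) \<le> norm (p - q)"
proof -
  let ?w = "prox l \<phi> p" and ?z = "prox l \<phi> q"
  obtain A B where A: "\<phi> ?w = ereal A" and B: "\<phi> ?z = ereal B"
    using prox_finite[OF l] by metis
  have "(norm (?w - ?z))\<^sup>2 \<le> (p - q) \<bullet> (?w - ?z)"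
    using prox_quadratic_growth[OF l A B] prox_quadratic_growth[OF l B A]
    by (simp add: power2_norm_eq_inner inner_simps inner_commute
        add_divide_distrib diff_divide_distrib)
  also have "\<dots> \<le> norm (p - q) * norm (?w - ?z)"
    by (rule norm_cauchy_schwarz)
  finally show ?thesis
    by (cases "?w = ?z") (auto simp: power2_eq_square)
qed

lemma prox_zero:
  assumes "l > 0"
  shows "prox l \<phi> 0 = 0"
proof -
  have "prox_obj l 0 (prox l \<phi> 0) \<le> ereal 0"
    using prox_minimises[OF assms, of 0 0] by (simp add: prox_obj_zero)
  then have "0 \<le> (0 - 1 / 2 * (norm (prox l \<phi> 0 - 0))\<^sup>2) / l"
    unfolding prox_obj_le_iff[OF assms] using nonneg[of "prox l \<phi> 0"]
    by (metis ereal_less_eq(3) order_trans zero_ereal_def)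
  then show ?thesis
    using assms by (simp add: zero_le_divide_iff divide_le_0_iff)
qed

text \<open>Since \<open>1 + h * \<gamma>\<close> is at least 1, the coefficients satisfy
  \<open>a \<le> 1\<close> and \<open>l \<le> h\<close>. The resulting constants are free of
  \<gamma>.\<close>

lemma prox_step_lipschitz:
  assumes "h > 0" "\<gamma> \<ge> 0"
  shows "norm (prox_step \<phi> \<gamma> h v G - prox_step \<phi> \<gamma> h w K) \<le> norm (v - w) + h * norm (G - K)"
proof -
  define a l where "a = 1 / (1 + h * \<gamma>)" and "l = h / (1 + h * \<gamma>)"
  have pos: "1 + h * \<gamma> \<ge> 1"
    using assms by simp
  then have al: "0 \<le> a" "a \<le> 1" "0 < l" "l \<le> h"
    using assms by (auto simp: a_def l_def divide_le_eq intro!: divide_pos_pos add_pos_nonneg)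
  have "norm (prox_step \<phi> \<gamma> h v G - prox_step \<phi> \<gamma> h w K)
      \<le> norm ((a *\<^sub>R v - l *\<^sub>R G) - (a *\<^sub>R w - l *\<^sub>R K))"
    unfolding prox_step_def Let_def a_def[symmetric] l_def[symmetric]
    by (rule prox_nonexpansive[OF al(3)])
  also have "(a *\<^sub>R v - l *\<^sub>R G) - (a *\<^sub>R w - l *\<^sub>R K) = a *\<^sub>R (v - w) - l *\<^sub>R (G - K)"
    by (simp add: algebra_simps)
  also have "norm \<dots> \<le> a * norm (v - w) + l * norm (G - K)"
    using norm_triangle_ineq4[of "a *\<^sub>R (v - w)" "l *\<^sub>R (G - K)"] al by simp
  also have "\<dots> \<le> 1 * norm (v - w) + h * norm (G - K)"
    using al by (intro add_mono mult_right_mono) auto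
  finally show ?thesis
    by simp
qed

text \<open>Rest is a fixed state, so comparing a step with it turns the Lipschitz estimate into a
  growth bound.\<close>

lemma prox_step_zero:
  assumes "h > 0" "\<gamma> \<ge> 0"
  shows "prox_step \<phi> \<gamma> h 0 0 = 0"
proof -
  have "1 + h * \<gamma> > 0"
    using assms by (simp add: add_pos_nonneg)
  then show ?thesis
    using assms by (simp add: prox_step_def prox_zero)
qed

end

section \<open>Stability and consistency of the schemes\<close>

text \<open>Each factor \<open>1 + c * h\<close> is absorbed into an exponential, and each source
  \<open>h * K\<close> is enlarged by an exponential that is at least 1. The recursion is required
  only below \<open>k\<close>, because the error recursion is available only up to time
  \<open>T\<close>.\<close>

lemma discrete_gronwall:
  fixes e :: "nat \<Rightarrow> real"
  assumes step: "\<And>j. j < k \<Longrightarrow> e (Suc j) \<le> (1 + c * h) * e j + h * K"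
    and nonneg: "0 \<le> e 0" "0 \<le> c" "0 \<le> h" "0 \<le> K"
  shows "e k \<le> (e 0 + real k * h * K) * exp (c * (real k * h))"
  using step
proof (induction k)
  case 0
  then show ?case by simp
next
  case (Suc k)
  let ?E = "exp (c * (real k * h))"
  have "e (Suc k) \<le> (1 + c * h) * e k + h * K"
    using Suc.prems by simp
  also have "\<dots> \<le> exp (c * h) * ((e 0 + real k * h * K) * ?E) + h * K"
  proof (rule add_right_mono)
    have "(1 + c * h) * e k \<le> (1 + c * h) * ((e 0 + real k * h * K) * ?E)"
      using Suc nonneg by (intro mult_left_mono) auto
    also have "\<dots> \<le> exp (c * h) * ((e 0 + real k * h * K) * ?E)"
      using nonneg exp_ge_add_one_self[of "c * h"] by (intro mult_right_mono) auto
    finally show "(1 + c * h) * e k \<le> exp (c * h) * ((e 0 + real k * h * K) * ?E)" .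
  qed
  also have "\<dots> \<le> exp (c * h) * ((e 0 + real k * h * K) * ?E) + h * K * (exp (c * h) * ?E)"
  proof -
    have "1 \<le> exp (c * h) * ?E"
      unfolding exp_add[symmetric] using nonneg by simp
    then have "h * K * 1 \<le> h * K * (exp (c * h) * ?E)"
      using nonneg by (intro mult_left_mono) auto
    then show ?thesis
      by simp
  qed
  also have "\<dots> = (e 0 + real (Suc k) * h * K) * (exp (c * h) * ?E)"
    by (simp add: algebra_simps)
  also have "exp (c * h) * ?E = exp (c * (real (Suc k) * h))"
    unfolding exp_add[symmetric] by (simp add: algebra_simps)
  finally show ?case .
qed

text \<open>On the segment from \<open>x\<close> to \<open>x + u\<close> the derivative deviates
  from \<open>H x\<close> by at most \<open>M * norm u\<close>, and the mean value inequality
  integrates this. The sharper factor 1/2 would only change the final constant.\<close>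

lemma gradient_taylor:
  fixes g :: "'a::real_normed_vector \<Rightarrow> 'a" and H :: "'a \<Rightarrow> 'a \<Rightarrow>\<^sub>L 'a"
  assumes der: "\<And>x. (g has_derivative blinfun_apply (H x)) (at x)"
    and lip: "M-lipschitz_on S H" and S: "convex S" "x \<in> S" "x + u \<in> S"
  shows "norm (g (x + u) - g x - H x u) \<le> M * (norm u)\<^sup>2"
proof -
  let ?C = "closed_segment x (x + u)"
  have sub: "?C \<subseteq> S"
    using S by (simp add: closed_segment_subset)
  have "norm (g (x + u) - g x - blinfun_apply (H x) ((x + u) - x)) \<le> norm ((x + u) - x) * (M * norm u)"
  proof (rule differentiable_bound_linearization[where S = ?C and f' = "\<lambda>x. blinfun_apply (H x)"])
    show "x + t *\<^sub>R (x + u - x) \<in> ?C" if "t \<in> {0..1}" for t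
      using that unfolding closed_segment_image_interval by (force simp: algebra_simps)
    show "(g has_derivative blinfun_apply (H y)) (at y within ?C)" for y
      using der by (rule has_derivative_at_withinI)
    show "onorm (blinfun_apply (H y) - blinfun_apply (H x)) \<le> M * norm u" if "y \<in> ?C" for y
    proof -
      have "blinfun_apply (H y) - blinfun_apply (H x) = blinfun_apply (H y - H x)"
        by (auto simp: blinfun.diff_left)
      then have "onorm (blinfun_apply (H y) - blinfun_apply (H x)) = dist (H y) (H x)"
        by (simp add: norm_blinfun.rep_eq dist_norm)
      also have "\<dots> \<le> M * dist y x"
        using that sub S by (intro lipschitz_onD[OF lip]) auto
      also have "\<dots> \<le> M * norm u"
        using segment_bound(1)[OF that] lipschitz_on_nonneg[OF lip]
        by (intro mult_left_mono) (auto simp: dist_norm norm_minus_commute)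
      finally show ?thesis .
    qed
  qed simp
  then show ?thesis
    by (simp add: power2_eq_square mult_ac)
qed

text \<open>Both evaluations of the Hessian damping agree with \<open>g x + \<beta> *\<^sub>R H x v\<close> up to the Taylor
  remainders at \<open>x + \<beta> *\<^sub>R v\<close> and \<open>x - h *\<^sub>R v\<close>.\<close>

lemma damping_defect:
  fixes g :: "'a::real_normed_vector \<Rightarrow> 'a" and H :: "'a \<Rightarrow> 'a \<Rightarrow>\<^sub>L 'a"
  assumes der: "\<And>x. (g has_derivative blinfun_apply (H x)) (at x)"
    and lip: "M-lipschitz_on S H" and S: "convex S" "x \<in> S" "x + \<beta> *\<^sub>R v \<in> S" "x - h *\<^sub>R v \<in> S"
    and pos: "0 \<le> \<beta>" "0 < h"
  shows "norm (g (x + \<beta> *\<^sub>R v) - (g x + (\<beta> / h) *\<^sub>R (g x - g (x - h *\<^sub>R v))))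
    \<le> M * (norm v)\<^sup>2 * (\<beta>\<^sup>2 + \<beta> * h)"
proof -
  let ?a = "g (x + \<beta> *\<^sub>R v) - g x - H x (\<beta> *\<^sub>R v)"
  let ?b = "g (x + (- h) *\<^sub>R v) - g x - H x ((- h) *\<^sub>R v)"
  have a: "norm ?a \<le> M * (norm (\<beta> *\<^sub>R v))\<^sup>2"
    using S by (intro gradient_taylor[OF der lip]) auto
  have b: "norm ?b \<le> M * (norm ((- h) *\<^sub>R v))\<^sup>2"
    using S by (intro gradient_taylor[OF der lip]) auto
  \<comment> \<open>The linear parts cancel: \<open>H x (\<beta> *\<^sub>R v)\<close> against
    \<open>\<beta> / h\<close> times \<open>H x (h *\<^sub>R v)\<close>.\<close>
  have "g (x + \<beta> *\<^sub>R v) - (g x + (\<beta> / h) *\<^sub>R (g x - g (x - h *\<^sub>R v))) = ?a + (\<beta> / h) *\<^sub>R ?b"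
    using pos by (simp add: blinfun.scaleR_right blinfun.minus_right algebra_simps)
  also have "norm \<dots> \<le> norm ?a + (\<beta> / h) * norm ?b"
    using norm_triangle_ineq[of ?a "(\<beta> / h) *\<^sub>R ?b"] pos by simp
  also have "\<dots> \<le> M * (norm (\<beta> *\<^sub>R v))\<^sup>2 + (\<beta> / h) * (M * (norm ((- h) *\<^sub>R v))\<^sup>2)"
    using pos a b by (intro add_mono mult_left_mono) auto
  \<comment> \<open>The forward remainder gives \<beta> squared; the backward one, of order h
    squared, is divided by h and gives \<beta> times h.\<close>
  also have "\<dots> = M * (norm v)\<^sup>2 * (\<beta>\<^sup>2 + \<beta> * h)"
    using pos by (simp add: power_mult_distrib power2_eq_square field_simps)
  finally show ?thesis .
qed

text \<open>One-step estimate shared by the a priori bound and the error bound: \<open>p\<close> and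
  \<open>q\<close> measure position and velocity, and \<open>K\<close> is the source. The position
  update uses the new velocity, which costs the factor \<open>1 + h\<close>, bounded by
  \<open>1 + hbar\<close>.\<close>

lemma damped_step_bound:
  fixes p q p' q' :: real
  assumes "0 \<le> p" "0 \<le> q" "0 \<le> L" "0 \<le> N" "0 \<le> K" "0 < h" "h \<le> hbar"
    and q': "q' \<le> q + h * (L * p + N * q + K)" and p': "p' \<le> p + h * q'"
  shows "p' + q' \<le> (1 + (1 + (1 + hbar) * (L + N)) * h) * (p + q) + h * ((1 + hbar) * K)"
proof -
  have "p' + q' \<le> p + (1 + h) * q'"
    using p' by (simp add: algebra_simps)
  also have "\<dots> \<le> p + (1 + h) * (q + h * (L * p + N * q + K))"
    using q' assms by (intro add_left_mono mult_left_mono) auto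
  also have "\<dots> = p + q + h * q + (1 + h) * (h * (L * p + N * q + K))"
    by (simp add: algebra_simps)
  also have "\<dots> \<le> p + q + h * (p + q) + (1 + hbar) * (h * ((L + N) * (p + q) + K))"
    using assms by (intro add_mono mult_mono) (auto simp: algebra_simps)
  also have "\<dots> = (1 + (1 + (1 + hbar) * (L + N)) * h) * (p + q) + h * ((1 + hbar) * K)"
    by (simp add: algebra_simps)
  finally show ?thesis .
qed

section \<open>One-step recursions of the two schemes\<close>

lemma implicit_0 [simp]:
  "implicit_x gradf \<phi> \<gamma> x0 v0 \<beta> h 0 = x0" "implicit_v gradf \<phi> \<gamma> x0 v0 \<beta> h 0 = v0"
  by (simp_all add: implicit_x_def implicit_v_def)

lemma explicit_0 [simp]:
  "explicit_x gradf \<phi> \<gamma> x0 v0 \<beta> h 0 = x0" "explicit_v gradf \<phi> \<gamma> x0 v0 \<beta> h 0 = v0"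
  by (simp_all add: explicit_x_def explicit_v_def)

lemma implicit_v_Suc:
  "implicit_v gradf \<phi> \<gamma> x0 v0 \<beta> h (Suc k) =
    prox_step \<phi> \<gamma> h (implicit_v gradf \<phi> \<gamma> x0 v0 \<beta> h k)
      (gradf (implicit_x gradf \<phi> \<gamma> x0 v0 \<beta> h k + \<beta> *\<^sub>R implicit_v gradf \<phi> \<gamma> x0 v0 \<beta> h k))"
  by (simp add: implicit_x_def implicit_v_def Let_def split: prod.splits)

lemma implicit_x_Suc:
  "implicit_x gradf \<phi> \<gamma> x0 v0 \<beta> h (Suc k) =
    implicit_x gradf \<phi> \<gamma> x0 v0 \<beta> h k + h *\<^sub>R implicit_v gradf \<phi> \<gamma> x0 v0 \<beta> h (Suc k)"
  by (simp add: implicit_x_def implicit_v_def Let_def split: prod.splits)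

lemma explicit_x_Suc:
  "explicit_x gradf \<phi> \<gamma> x0 v0 \<beta> h (Suc k) =
    explicit_x gradf \<phi> \<gamma> x0 v0 \<beta> h k + h *\<^sub>R explicit_v gradf \<phi> \<gamma> x0 v0 \<beta> h (Suc k)"
  by (simp add: explicit_x_def explicit_v_def Let_def split: prod.splits)

text \<open>At index 0 this is the ghost point; afterwards it inverts the position update. It makes
  the backward gradient difference a function of the current position and velocity.\<close>

lemma explicit_state_prev:
  "fst (explicit_state gradf \<phi> \<gamma> x0 v0 \<beta> h k) =
    explicit_x gradf \<phi> \<gamma> x0 v0 \<beta> h k - h *\<^sub>R explicit_v gradf \<phi> \<gamma> x0 v0 \<beta> h k"
  by (cases k) (simp_all add: explicit_x_def explicit_v_def Let_def split: prod.splits)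

text \<open>The ghost value \<open>x0 - h *\<^sub>R v0\<close> makes the recursion for \<open>v\<close> autonomous from the first step.\<close>

lemma explicit_v_Suc:
  "explicit_v gradf \<phi> \<gamma> x0 v0 \<beta> h (Suc k) =
    (let x = explicit_x gradf \<phi> \<gamma> x0 v0 \<beta> h k; v = explicit_v gradf \<phi> \<gamma> x0 v0 \<beta> h k
     in prox_step \<phi> \<gamma> h v (gradf x + (\<beta> / h) *\<^sub>R (gradf x - gradf (x - h *\<^sub>R v))))"
  using explicit_state_prev[of gradf \<phi> \<gamma> x0 v0 \<beta> h k]
  by (auto simp: explicit_x_def explicit_v_def Let_def split: prod.splits)

section \<open>A priori bound and propagation of the error\<close>

lemma norm_explicit_damping_le:
  fixes g :: "'a::real_normed_vector \<Rightarrow> 'a"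
  assumes lip: "L-lipschitz_on UNIV g" and pos: "0 \<le> \<beta>" "\<beta> \<le> \<beta>bar" "0 < h"
  shows "norm (g x + (\<beta> / h) *\<^sub>R (g x - g (x - h *\<^sub>R v)))
    \<le> L * norm x + L * \<beta>bar * norm v + norm (g 0)"
proof -
  have lipD: "norm (g y - g z) \<le> L * norm (y - z)" for y z
    using lipschitz_onD[OF lip, of y z] by (simp add: dist_norm)
  have L: "0 \<le> L"
    using lip by (rule lipschitz_on_nonneg)
  have "norm (g x + (\<beta> / h) *\<^sub>R (g x - g (x - h *\<^sub>R v)))
      \<le> norm (g x) + \<beta> / h * norm (g x - g (x - h *\<^sub>R v))"
    using norm_triangle_ineq[of "g x" "(\<beta> / h) *\<^sub>R (g x - g (x - h *\<^sub>R v))"] pos by simp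
  \<comment> \<open>The two gradient arguments differ by \<open>h *\<^sub>R v\<close>, so the step
    size cancels against \<open>\<beta> / h\<close> and the bound is uniform in h.\<close>
  also have "\<dots> \<le> (L * norm x + norm (g 0)) + \<beta> / h * (L * (h * norm v))"
    using pos lipD[of x 0] lipD[of x "x - h *\<^sub>R v"] norm_triangle_ineq2[of "g x" "g 0"]
    by (intro add_mono mult_left_mono) auto
  also have "\<dots> = L * norm x + L * \<beta> * norm v + norm (g 0)"
    using pos by simp
  also have "\<dots> \<le> L * norm x + L * \<beta>bar * norm v + norm (g 0)"
    using L pos by (intro add_mono mult_mono) auto
  finally show ?thesis .
qed

text \<open>The damping term grows at most linearly in position and velocity, so Gronwall applies.
  The bound contains neither \<beta> nor h, which allows one Hessian Lipschitz constant for all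
  parameters.\<close>

lemma (in nonneg_convex_lsc) explicit_bounded:
  fixes gradf :: "'a \<Rightarrow> 'a"
  assumes lip: "L-lipschitz_on UNIV gradf" and "0 \<le> \<gamma>"
    and pos: "0 \<le> \<beta>" "\<beta> \<le> \<beta>bar" "0 < h" "h \<le> hbar" and kT: "real k * h \<le> T"
  shows "norm (explicit_x gradf \<phi> \<gamma> x0 v0 \<beta> h k) + norm (explicit_v gradf \<phi> \<gamma> x0 v0 \<beta> h k)
    \<le> (norm x0 + norm v0 + T * ((1 + hbar) * norm (gradf 0)))
        * exp ((1 + (1 + hbar) * (L + L * \<beta>bar)) * T)"
proof -
  define x v where "x = explicit_x gradf \<phi> \<gamma> x0 v0 \<beta> h" and "v = explicit_v gradf \<phi> \<gamma> x0 v0 \<beta> h"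
  define c K where "c = 1 + (1 + hbar) * (L + L * \<beta>bar)" and "K = (1 + hbar) * norm (gradf 0)"
  have L: "0 \<le> L"
    using lip by (rule lipschitz_on_nonneg)
  have c: "0 \<le> c" and K: "0 \<le> K"
    using L pos by (auto simp: c_def K_def)
  have step: "norm (x (Suc j)) + norm (v (Suc j)) \<le> (1 + c * h) * (norm (x j) + norm (v j)) + h * K" for j
    unfolding c_def K_def
  proof (rule damped_step_bound)
    let ?G = "gradf (x j) + (\<beta> / h) *\<^sub>R (gradf (x j) - gradf (x j - h *\<^sub>R v j))"
    have "norm (v (Suc j)) = norm (prox_step \<phi> \<gamma> h (v j) ?G - prox_step \<phi> \<gamma> h 0 0)"
      using pos \<open>0 \<le> \<gamma>\<close> by (simp add: prox_step_zero v_def x_def explicit_v_Suc Let_def)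
    also have "\<dots> \<le> norm (v j) + h * norm ?G"
      using prox_step_lipschitz[of h \<gamma> "v j" ?G 0 0] pos \<open>0 \<le> \<gamma>\<close> by simp
    also have "\<dots> \<le> norm (v j) + h * (L * norm (x j) + L * \<beta>bar * norm (v j) + norm (gradf 0))"
      using pos by (intro add_left_mono mult_left_mono norm_explicit_damping_le lip) auto
    finally show "norm (v (Suc j))
      \<le> norm (v j) + h * (L * norm (x j) + L * \<beta>bar * norm (v j) + norm (gradf 0))" .
    show "norm (x (Suc j)) \<le> norm (x j) + h * norm (v (Suc j))"
      using norm_triangle_ineq[of "x j" "h *\<^sub>R v (Suc j)"] pos
      by (simp add: x_def v_def explicit_x_Suc)
  qed (use L pos in auto)
  have "norm (x k) + norm (v k) \<le> (norm (x 0) + norm (v 0) + real k * h * K) * exp (c * (real k * h))"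
    by (rule discrete_gronwall[where e = "\<lambda>k. norm (x k) + norm (v k)", OF step])
      (use c K pos in auto)
  also have "\<dots> \<le> (norm x0 + norm v0 + T * K) * exp (c * T)"
    using c K pos kT order_trans[OF _ kT, of 0]
    by (intro mult_mono add_mono) (auto simp: x_def v_def intro!: mult_right_mono mult_left_mono)
  finally show ?thesis
    unfolding c_def K_def x_def v_def .
qed

text \<open>The difference of the damping terms is split at the implicit term evaluated on the
  explicit trajectory. One part is controlled by the global Lipschitz constant of the gradient, the
  other by \<open>damping_defect\<close>. Thus the Hessian is compared only near the explicit
  trajectory, and the implicit one needs no separate bound.\<close>

lemma (in nonneg_convex_lsc) implicit_explicit_diff:
  fixes gradf :: "'a \<Rightarrow> 'a" and hessf :: "'a \<Rightarrow> 'a \<Rightarrow>\<^sub>L 'a"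
  assumes der: "\<And>x. (gradf has_derivative blinfun_apply (hessf x)) (at x)"
    and lip: "L-lipschitz_on UNIV gradf" and "0 \<le> \<gamma>"
    and pos: "0 \<le> \<beta>" "\<beta> \<le> \<beta>bar" "0 < h" "h \<le> hbar" and kT: "real k * h \<le> T"
    and R: "\<And>j. real j * h \<le> T \<Longrightarrow>
      norm (explicit_x gradf \<phi> \<gamma> x0 v0 \<beta> h j) + norm (explicit_v gradf \<phi> \<gamma> x0 v0 \<beta> h j) \<le> R"
    and hlip: "M-lipschitz_on (cball 0 (R * (1 + \<beta>bar + hbar))) hessf"
  shows "norm (implicit_x gradf \<phi> \<gamma> x0 v0 \<beta> h k - explicit_x gradf \<phi> \<gamma> x0 v0 \<beta> h k)
      + norm (implicit_v gradf \<phi> \<gamma> x0 v0 \<beta> h k - explicit_v gradf \<phi> \<gamma> x0 v0 \<beta> h k)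
    \<le> T * ((1 + hbar) * (M * R\<^sup>2 * (\<beta>\<^sup>2 + \<beta> * h))) * exp ((1 + (1 + hbar) * (L + L * \<beta>bar)) * T)"
proof -
  define x v where "x = explicit_x gradf \<phi> \<gamma> x0 v0 \<beta> h" and "v = explicit_v gradf \<phi> \<gamma> x0 v0 \<beta> h"
  define y w where "y = implicit_x gradf \<phi> \<gamma> x0 v0 \<beta> h" and "w = implicit_v gradf \<phi> \<gamma> x0 v0 \<beta> h"
  define D where "D = M * R\<^sup>2 * (\<beta>\<^sup>2 + \<beta> * h)"
  define c K where "c = 1 + (1 + hbar) * (L + L * \<beta>bar)" and "K = (1 + hbar) * D"
  have L: "0 \<le> L" and M: "0 \<le> M"
    using lip hlip by (auto dest: lipschitz_on_nonneg)
  have D: "0 \<le> D"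
    using M pos by (simp add: D_def)
  have c: "0 \<le> c" and K: "0 \<le> K"
    using L D pos by (auto simp: c_def K_def)
  have step: "norm (y (Suc j) - x (Suc j)) + norm (w (Suc j) - v (Suc j))
      \<le> (1 + c * h) * (norm (y j - x j) + norm (w j - v j)) + h * K" if "j < k" for j
    unfolding c_def K_def
  proof (rule damped_step_bound)
    let ?G = "gradf (x j) + (\<beta> / h) *\<^sub>R (gradf (x j) - gradf (x j - h *\<^sub>R v j))"
    have "real j * h \<le> real k * h"
      using that pos by (intro mult_right_mono) auto
    then have "norm (x j) + norm (v j) \<le> R"
      using kT R[of j] unfolding x_def v_def by linarith
    then have xR: "norm (x j) \<le> R" and vR: "norm (v j) \<le> R" and R0: "0 \<le> R"
      using norm_ge_zero[of "x j"] norm_ge_zero[of "v j"] by linarith+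
    \<comment> \<open>The radius is chosen so that the ball holds the three points of the defect
      estimate, given by \<open>s\<close> equal to 0, \<beta> and -h.\<close>
    have mem: "x j + s *\<^sub>R v j \<in> cball 0 (R * (1 + \<beta>bar + hbar))" if "\<bar>s\<bar> \<le> \<beta>bar + hbar" for s
    proof -
      have "norm (x j + s *\<^sub>R v j) \<le> norm (x j) + \<bar>s\<bar> * norm (v j)"
        using norm_triangle_ineq[of "x j" "s *\<^sub>R v j"] by simp
      also have "\<dots> \<le> R + (\<beta>bar + hbar) * R"
        using that xR vR by (intro add_mono mult_mono) auto
      finally show ?thesis
        by (simp add: algebra_simps)
    qed
    have "norm (gradf (x j + \<beta> *\<^sub>R v j) - ?G) \<le> M * (norm (v j))\<^sup>2 * (\<beta>\<^sup>2 + \<beta> * h)"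
      using mem[of 0] mem[of \<beta>] mem[of "- h"] pos
      by (intro damping_defect[OF der hlip]) auto
    also have "\<dots> \<le> D"
      unfolding D_def using M pos vR by (intro mult_right_mono mult_left_mono power_mono) auto
    finally have defect: "norm (gradf (x j + \<beta> *\<^sub>R v j) - ?G) \<le> D" .
    have "norm (gradf (y j + \<beta> *\<^sub>R w j) - gradf (x j + \<beta> *\<^sub>R v j))
        \<le> L * norm ((y j + \<beta> *\<^sub>R w j) - (x j + \<beta> *\<^sub>R v j))"
      using lipschitz_onD[OF lip] by (simp add: dist_norm)
    also have "(y j + \<beta> *\<^sub>R w j) - (x j + \<beta> *\<^sub>R v j) = (y j - x j) + \<beta> *\<^sub>R (w j - v j)"
      by (simp add: algebra_simps)
    also have "L * norm \<dots> \<le> L * (norm (y j - x j) + \<beta> * norm (w j - v j))"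
      using norm_triangle_ineq[of "y j - x j" "\<beta> *\<^sub>R (w j - v j)"] L pos
      by (intro mult_left_mono) auto
    also have "\<dots> \<le> L * (norm (y j - x j) + \<beta>bar * norm (w j - v j))"
      using L pos by (intro mult_left_mono add_left_mono mult_right_mono) auto
    finally have "norm (gradf (y j + \<beta> *\<^sub>R w j) - ?G)
        \<le> L * norm (y j - x j) + L * \<beta>bar * norm (w j - v j) + D"
      using defect norm_triangle_ineq[of "gradf (y j + \<beta> *\<^sub>R w j) - gradf (x j + \<beta> *\<^sub>R v j)"
          "gradf (x j + \<beta> *\<^sub>R v j) - ?G"]
      by (simp add: algebra_simps)
    then have "h * norm (gradf (y j + \<beta> *\<^sub>R w j) - ?G)
        \<le> h * (L * norm (y j - x j) + L * \<beta>bar * norm (w j - v j) + D)"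
      using pos by (intro mult_left_mono) auto
    moreover have "norm (w (Suc j) - v (Suc j))
        \<le> norm (w j - v j) + h * norm (gradf (y j + \<beta> *\<^sub>R w j) - ?G)"
      unfolding w_def v_def implicit_v_Suc explicit_v_Suc Let_def y_def x_def
      using pos \<open>0 \<le> \<gamma>\<close> by (intro prox_step_lipschitz) auto
    ultimately show "norm (w (Suc j) - v (Suc j))
        \<le> norm (w j - v j) + h * (L * norm (y j - x j) + L * \<beta>bar * norm (w j - v j) + D)"
      by linarith
    have "y (Suc j) - x (Suc j) = (y j - x j) + h *\<^sub>R (w (Suc j) - v (Suc j))"
      by (simp add: x_def v_def y_def w_def explicit_x_Suc implicit_x_Suc algebra_simps)
    then show "norm (y (Suc j) - x (Suc j)) \<le> norm (y j - x j) + h * norm (w (Suc j) - v (Suc j))"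
      using norm_triangle_ineq[of "y j - x j" "h *\<^sub>R (w (Suc j) - v (Suc j))"] pos by simp
  qed (use L D pos in auto)
  have "norm (y k - x k) + norm (w k - v k)
      \<le> (norm (y 0 - x 0) + norm (w 0 - v 0) + real k * h * K) * exp (c * (real k * h))"
    by (rule discrete_gronwall[where e = "\<lambda>k. norm (y k - x k) + norm (w k - v k)", OF step])
      (use c K pos in auto)
  \<comment> \<open>Both schemes start from the same data, so the initial error vanishes and only
    the accumulated defect remains.\<close>
  also have "\<dots> \<le> T * K * exp (c * T)"
    using c K pos kT order_trans[OF _ kT, of 0]
    by (intro mult_mono) (auto simp: x_def v_def y_def w_def intro!: mult_right_mono mult_left_mono)
  finally show ?thesis
    unfolding c_def K_def D_def x_def v_def y_def w_def .
qed

section \<open>Quadratic potentials\<close>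

lemma quadratic_gradient_affine:
  fixes f :: "'a::real_inner \<Rightarrow> real"
  assumes grad: "\<And>x. GDERIV f x :> gradf x" and quad: "quadratic_fun f"
  obtains A :: "'a \<Rightarrow>\<^sub>L 'a" and b where "\<And>x. gradf x = blinfun_apply A x + b"
proof -
  obtain A :: "'a \<Rightarrow>\<^sub>L 'a" and b c
    where sym: "\<And>x y. blinfun_apply A x \<bullet> y = x \<bullet> blinfun_apply A y"
      and f: "\<And>x. f x = 1 / 2 * (blinfun_apply A x \<bullet> x) + b \<bullet> x + c"
    using quad unfolding quadratic_fun_def by blast
  have "gradf x = blinfun_apply A x + b" for x
  proof -
    have "(f has_derivative (\<lambda>u. 1 / 2 * (blinfun_apply A x \<bullet> u + blinfun_apply A u \<bullet> x) + b \<bullet> u)) (at x)"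
      unfolding f[abs_def] by (auto intro!: derivative_eq_intros)
    moreover have "(f has_derivative (\<lambda>u. u \<bullet> gradf x)) (at x)"
      using grad[of x] unfolding gderiv_def .
    ultimately have "(\<lambda>u. 1 / 2 * (blinfun_apply A x \<bullet> u + blinfun_apply A u \<bullet> x) + b \<bullet> u) = (\<lambda>u. u \<bullet> gradf x)"
      by (rule has_derivative_unique)
    then have "u \<bullet> gradf x = 1 / 2 * (blinfun_apply A x \<bullet> u + blinfun_apply A u \<bullet> x) + b \<bullet> u" for u
      by (simp add: fun_eq_iff)
    \<comment> \<open>Symmetry of \<open>A\<close> merges the two halves of the derivative of the
      quadratic form.\<close>
    then have "u \<bullet> gradf x = u \<bullet> (blinfun_apply A x + b)" for u
      using sym[of u x] by (simp add: inner_add_right inner_commute)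
    then show ?thesis
      by (metis vector_eq_rdot inner_commute)
  qed
  then show ?thesis
    using that by blast
qed

text \<open>With an affine gradient both damping terms equal
  \<open>A x + b + \<beta> *\<^sub>R A v\<close>, so both schemes feed identical arguments to the
  proximal step, whatever \<phi> is.\<close>

lemma implicit_eq_explicit_affine:
  fixes A :: "'a::real_inner \<Rightarrow>\<^sub>L 'a"
  assumes gradf: "\<And>x. gradf x = blinfun_apply A x + b" and "h \<noteq> 0"
  shows "implicit_x gradf \<phi> \<gamma> x0 v0 \<beta> h k = explicit_x gradf \<phi> \<gamma> x0 v0 \<beta> h k \<and>
    implicit_v gradf \<phi> \<gamma> x0 v0 \<beta> h k = explicit_v gradf \<phi> \<gamma> x0 v0 \<beta> h k"
proof (induction k)
  case 0
  show ?case by simp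
next
  case (Suc k)
  have "gradf (x + \<beta> *\<^sub>R v) = gradf x + (\<beta> / h) *\<^sub>R (gradf x - gradf (x - h *\<^sub>R v))" for x v
    using \<open>h \<noteq> 0\<close> by (simp add: gradf blinfun.bilinear_simps)
  with Suc show ?case
    by (simp add: implicit_x_Suc explicit_x_Suc implicit_v_Suc explicit_v_Suc Let_def)
qed

section \<open>The uniform error estimate and exact agreement for quadratic potentials\<close>

theorem theorem5p3:
  fixes f :: "'a::{real_inner,complete_space} \<Rightarrow> real"
    and gradf :: "'a \<Rightarrow> 'a"
    and hessf :: "'a \<Rightarrow> 'a \<Rightarrow>\<^sub>L 'a"
    and \<phi> :: "'a \<Rightarrow> ereal"
    and x0 v0 :: 'a
    and \<gamma> L \<kappa> r :: real
  assumes gamma_pos: "\<gamma> > 0"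
    and grad: "\<And>x. GDERIV f x :> gradf x"
    and hess: "\<And>x. (gradf has_derivative blinfun_apply (hessf x)) (at x)"
    and hess_cont: "continuous_on UNIV hessf"
    and f_bdd: "bdd_below (range f)"
    and L_nonneg: "L \<ge> 0"
    and grad_lip: "L-lipschitz_on UNIV gradf"
    and hess_bdd: "\<And>S. bounded S \<Longrightarrow> bounded (hessf ` S)"
    and hess_lip: "\<And>S. bounded S \<Longrightarrow> \<exists>M. M-lipschitz_on S hessf"
    and kappa_nonneg: "\<kappa> \<ge> 0"
    and hess_lower: "\<And>x u. blinfun_apply (hessf x) u \<bullet> u \<ge> - \<kappa> * (norm u)\<^sup>2"
    and phi_proper: "proper_fun \<phi>"
    and phi_lsc: "lsc_fun \<phi>"
    and phi_convex: "convex_fun \<phi>"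
    and phi_zero: "\<phi> 0 = 0"
    and phi_min: "\<And>x. \<phi> 0 \<le> \<phi> x"
    and r_pos: "r > 0"
    and dry_friction: "cball 0 r \<subseteq> subdifferential \<phi> 0"
  shows "(\<forall>T>0. \<forall>\<beta>bar>0. \<forall>hbar>0. \<exists>C>0.
            \<forall>\<beta> h. 0 \<le> \<beta> \<and> \<beta> \<le> \<beta>bar \<and> 0 < h \<and> h \<le> hbar \<longrightarrow>
              (MAX k\<in>{k::nat. 0 \<le> real k * h \<and> real k * h \<le> T}.
                 norm (implicit_x gradf \<phi> \<gamma> x0 v0 \<beta> h k - explicit_x gradf \<phi> \<gamma> x0 v0 \<beta> h k)
               + norm (implicit_v gradf \<phi> \<gamma> x0 v0 \<beta> h k - explicit_v gradf \<phi> \<gamma> x0 v0 \<beta> h k))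
              \<le> C * (\<beta>\<^sup>2 + \<beta> * h))
       \<and> (quadratic_fun f \<longrightarrow>
            (\<forall>\<beta>\<ge>0. \<forall>h>0. \<forall>k.
               implicit_x gradf \<phi> \<gamma> x0 v0 \<beta> h k = explicit_x gradf \<phi> \<gamma> x0 v0 \<beta> h k \<and>
               implicit_v gradf \<phi> \<gamma> x0 v0 \<beta> h k = explicit_v gradf \<phi> \<gamma> x0 v0 \<beta> h k))"
proof (intro conjI impI allI)
  interpret nonneg_convex_lsc \<phi>
    using phi_lsc phi_convex phi_zero phi_min by unfold_locales auto
  fix T \<beta>bar hbar :: real
  assume T: "T > 0" and bars: "\<beta>bar > 0" "hbar > 0"
  define E where "E = exp ((1 + (1 + hbar) * (L + L * \<beta>bar)) * T)"
  \<comment> \<open>This is the bound from \<open>explicit_bounded\<close>; it is fixed before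
    \<beta> and h are introduced, and so is the constant \<open>M\<close> obtained from it.\<close>
  define R where "R = (norm x0 + norm v0 + T * ((1 + hbar) * norm (gradf 0))) * E"
  obtain M where M: "M-lipschitz_on (cball 0 (R * (1 + \<beta>bar + hbar))) hessf"
    using hess_lip[OF bounded_cball] by blast
  \<comment> \<open>The added 1 keeps the constant strictly positive even when \<open>M\<close> or
    \<open>R\<close> is 0.\<close>
  define C where "C = T * ((1 + hbar) * (M * R\<^sup>2)) * E + 1"
  let ?d = "\<lambda>\<beta> h k. norm (implicit_x gradf \<phi> \<gamma> x0 v0 \<beta> h k - explicit_x gradf \<phi> \<gamma> x0 v0 \<beta> h k)
               + norm (implicit_v gradf \<phi> \<gamma> x0 v0 \<beta> h k - explicit_v gradf \<phi> \<gamma> x0 v0 \<beta> h k)"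
  show "\<exists>C>0. \<forall>\<beta> h. 0 \<le> \<beta> \<and> \<beta> \<le> \<beta>bar \<and> 0 < h \<and> h \<le> hbar \<longrightarrow>
    (MAX k\<in>{k::nat. 0 \<le> real k * h \<and> real k * h \<le> T}. ?d \<beta> h k) \<le> C * (\<beta>\<^sup>2 + \<beta> * h)"
  proof (intro exI[of _ C] conjI allI impI)
    show "C > 0"
      using T bars lipschitz_on_nonneg[OF M] unfolding C_def E_def
      by (intro add_nonneg_pos mult_nonneg_nonneg) auto
    fix \<beta> h assume "0 \<le> \<beta> \<and> \<beta> \<le> \<beta>bar \<and> 0 < h \<and> h \<le> hbar"
    then have pos: "0 \<le> \<beta>" "\<beta> \<le> \<beta>bar" "0 < h" "h \<le> hbar"
      by auto
    let ?K = "{k::nat. 0 \<le> real k * h \<and> real k * h \<le> T}"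
    \<comment> \<open>A maximum over a set of indices is meaningful only if the set is finite and
      nonempty; index 0 always belongs to it.\<close>
    have "?K \<subseteq> {..nat \<lceil>T / h\<rceil>}"
    proof
      fix k assume "k \<in> ?K"
      then have "real k \<le> T / h"
        using pos by (simp add: field_simps)
      then show "k \<in> {..nat \<lceil>T / h\<rceil>}"
        by (simp add: le_nat_iff) linarith
    qed
    then have "finite ?K"
      using finite_subset by blast
    moreover have "?K \<noteq> {}"
      using T by (auto intro!: exI[of _ "0::nat"])
    moreover have "?d \<beta> h k \<le> C * (\<beta>\<^sup>2 + \<beta> * h)" if "k \<in> ?K" for k
    proof -
      have "?d \<beta> h k \<le> T * ((1 + hbar) * (M * R\<^sup>2 * (\<beta>\<^sup>2 + \<beta> * h))) * E"
        unfolding E_def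
      proof (rule implicit_explicit_diff[OF hess grad_lip _ pos _ _ M])
        show "norm (explicit_x gradf \<phi> \<gamma> x0 v0 \<beta> h j) + norm (explicit_v gradf \<phi> \<gamma> x0 v0 \<beta> h j) \<le> R"
          if "real j * h \<le> T" for j
          unfolding R_def E_def by (rule explicit_bounded[OF grad_lip _ pos that]) (use gamma_pos in simp)
      qed (use gamma_pos that in auto)
      also have "\<dots> = (C - 1) * (\<beta>\<^sup>2 + \<beta> * h)"
        by (simp add: C_def algebra_simps)
      also have "\<dots> \<le> C * (\<beta>\<^sup>2 + \<beta> * h)"
        using pos by (intro mult_right_mono) auto
      finally show ?thesis .
    qed
    ultimately show "(MAX k\<in>?K. ?d \<beta> h k) \<le> C * (\<beta>\<^sup>2 + \<beta> * h)"
      by (subst Max_le_iff) auto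
  qed
next
  fix \<beta> h :: real and k
  assume quad: "quadratic_fun f" and "h > 0"
  obtain A :: "'a \<Rightarrow>\<^sub>L 'a" and b where "\<And>x. gradf x = blinfun_apply A x + b"
    using quadratic_gradient_affine[OF grad quad] by blast
  then have "implicit_x gradf \<phi> \<gamma> x0 v0 \<beta> h k = explicit_x gradf \<phi> \<gamma> x0 v0 \<beta> h k \<and>
      implicit_v gradf \<phi> \<gamma> x0 v0 \<beta> h k = explicit_v gradf \<phi> \<gamma> x0 v0 \<beta> h k"
    by (rule implicit_eq_explicit_affine) (use \<open>h > 0\<close> in simp)
  then show "implicit_x gradf \<phi> \<gamma> x0 v0 \<beta> h k = explicit_x gradf \<phi> \<gamma> x0 v0 \<beta> h k"
    "implicit_v gradf \<phi> \<gamma> x0 v0 \<beta> h k = explicit_v gradf \<phi> \<gamma> x0 v0 \<beta> h k"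
    by auto
qed

end
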